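(* For any convex function $f:[0,1]\to\mathbb{R}$ satisfying $f(0)=0$, any offline vertex $j\in J$, and any feasible assignment $(x_{ij})_{i\in I,j\in J}$ of the natural linear program, writing $x_j=\sum_{i\in I}x_{ij}$, $$\sum_{i\in I}\lambda_i f\Big(\frac{x_{ij}}{\lambda_i}\Big)\le\int_0^{-\ln(1-x_j)}f\big(e^{-\lambda}\big)\,d\lambda.$$
   Context: Let $I$ be a finite set of online vertex types and $J$ a finite set of offline vertices, with weights $w_{ij}\ge0$ and arrival rates $\lambda_i>0$. The natural linear program is: maximize $\sum_{i\in I}\sum_{j\in J}w_{ij}x_{ij}$ subject to $\sum_{j\in J}x_{ij}\le\lambda_i$ for all $i\in I$; $\sum_{i\in S}x_{ij}\le 1-\exp\big(-\sum_{i\in S}\lambda_i\big)$ for all $j\in J$ and all $S\subseteq I$; and $x_{ij}\ge0$ for all $i\in I$, $j\in J$. *)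

theory Defs
  imports "HOL-Analysis.Analysis"
begin

definition natural_lp_feasible ::
  "'i set \<Rightarrow> 'j set \<Rightarrow> ('i \<Rightarrow> real) \<Rightarrow> ('i \<Rightarrow> 'j \<Rightarrow> real) \<Rightarrow> bool" where
  "natural_lp_feasible I J lam x \<longleftrightarrow>
     (\<forall>i\<in>I. (\<Sum>j\<in>J. x i j) \<le> lam i) \<and>
     (\<forall>j\<in>J. \<forall>S. S \<subseteq> I \<longrightarrow> (\<Sum>i\<in>S. x i j) \<le> 1 - exp (- (\<Sum>i\<in>S. lam i))) \<and>
     (\<forall>i\<in>I. \<forall>j\<in>J. 0 \<le> x i j)"

text \<open>
  The integral in the main statement always exists, so the convention that \<^const>\<open>integral\<close>
  is 0 on non-integrable functions never applies. Note that a convex function on the closed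
  unit interval may be discontinuous at the end points.
\<close>

lemma convex_exp_integrable:
  fixes f :: "real \<Rightarrow> real"
  assumes f: "convex_on {0..1} f"
  shows "(\<lambda>t. f (exp (- t))) integrable_on {0..b}"
proof -
  have bd: "\<bar>f u\<bar> \<le> 2 * \<bar>f (1/2)\<bar> + \<bar>f 0\<bar> + \<bar>f 1\<bar>" if u: "u \<in> {0..1}" for u
  proof -
    have up: "f v \<le> \<bar>f 0\<bar> + \<bar>f 1\<bar>" if v: "v \<in> {0..1}" for v
    proof -
      have sc: "c * y \<le> \<bar>y\<bar>" if c: "0 \<le> c" "c \<le> 1" for c y :: real
        by (rule order_trans[OF mult_left_mono[OF abs_ge_self c(1)] mult_left_le_one_le[OF abs_ge_zero c]])
      have "f ((1 - v) *\<^sub>R 0 + v *\<^sub>R 1) \<le> (1 - v) * f 0 + v * f 1"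
        using v by (intro convex_onD[OF f]) auto
      then have "f v \<le> (1 - v) * f 0 + v * f 1" by simp
      also have "\<dots> \<le> \<bar>f 0\<bar> + \<bar>f 1\<bar>"
        using v by (intro add_mono sc) auto
      finally show ?thesis .
    qed
    have "f ((1 - 1/2) *\<^sub>R u + (1/2) *\<^sub>R (1 - u)) \<le> (1 - 1/2) * f u + (1/2) * f (1 - u)"
      using u by (intro convex_onD[OF f]) auto
    then have "f (1/2) \<le> (f u + f (1 - u)) / 2" by (simp add: field_simps)
    moreover have "f (1 - u) \<le> \<bar>f 0\<bar> + \<bar>f 1\<bar>" "f u \<le> \<bar>f 0\<bar> + \<bar>f 1\<bar>" using u by (auto intro!: up)
    moreover have "- f (1/2) \<le> \<bar>f (1/2)\<bar>" "0 \<le> \<bar>f (1/2)\<bar>" by (rule abs_ge_minus_self abs_ge_zero)+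
    ultimately show ?thesis unfolding abs_le_iff[of "f u"] by (auto simp: field_simps)
  qed
  have "continuous_on {0<..<1} f"
    by (rule convex_on_continuous[OF _ convex_on_subset[OF f]]) auto
  then have c: "continuous_on {0<..<b} (\<lambda>t. f (exp (- t)))"
    by (rule continuous_on_compose2[where f = "\<lambda>t::real. exp (- t)"])
       (auto intro!: continuous_intros)
  have "(\<lambda>t. f (exp (- t))) \<in> borel_measurable (lebesgue_on {0<..<b})"
    by (rule continuous_imp_measurable_on_sets_lebesgue[OF c]) auto
  moreover have "(\<lambda>_. 2 * \<bar>f (1/2)\<bar> + \<bar>f 0\<bar> + \<bar>f 1\<bar>) integrable_on {0<..<b}"
    unfolding integrable_on_open_interval_real by (rule integrable_const_ivl)
  moreover have "norm (f (exp (- t))) \<le> 2 * \<bar>f (1/2)\<bar> + \<bar>f 0\<bar> + \<bar>f 1\<bar>" if "t \<in> {0<..<b}" for t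
    using bd[of "exp (- t)"] that by simp
  ultimately have "(\<lambda>t. f (exp (- t))) integrable_on {0<..<b}"
    by (rule measurable_bounded_by_integrable_imp_integrable) auto
  then show ?thesis by (simp add: integrable_on_open_interval_real)
qed

end

theory Submission
  imports Defs
begin

text \<open>
  With \<open>p\<^sub>i = x\<^sub>i\<^sub>j / \<lambda>\<^sub>i\<close> sorted decreasingly, the step function with value \<open>p\<^sub>i\<close> on an interval
  of length \<open>\<lambda>\<^sub>i\<close> is majorised by \<open>exp (- t)\<close> truncated at \<open>T = - ln (1 - x\<^sub>j)\<close>: the constraints on
  the sets of indices with largest \<open>p\<^sub>i\<close> say so at the breakpoints, and the totals agree. The claim
  is then Karamata's inequality, proved by integrating supporting lines of \<open>f\<close> at the values \<open>p\<^sub>i\<close>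
  and summing by parts. Indices with \<open>p\<^sub>i = 0\<close> are dropped first, because \<open>f\<close> need not have
  a supporting line at the end points of the unit interval.
\<close>

text \<open>Monotonicity comes from adding the supporting lines at \<open>p\<close> and
  \<open>q\<close>, each evaluated at the other point. It makes the slopes at decreasing values
  \<open>p i\<close> decrease, as the summation by parts needs.\<close>

lemma convex_on_mono_supporting_slopes:
  fixes f :: "real \<Rightarrow> real"
  assumes f: "convex_on A f"
  obtains d where
    "\<And>p u. p \<in> interior A \<Longrightarrow> u \<in> A \<Longrightarrow> f p + d p * (u - p) \<le> f u"
    "mono_on (interior A) d"
proof -
  \<comment> \<open>This is the right derivative of \<open>f\<close> at interior points.\<close>
  define d where "d p = Inf ((\<lambda>t. (f p - f t) / (p - t)) ` ({p<..} \<inter> A))" for p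
  have sup: "f p + d p * (u - p) \<le> f u" if "p \<in> interior A" "u \<in> A" for p u
    using convex_le_Inf_differential[OF f that] by (simp add: d_def)
  have "mono_on (interior A) d"
  proof (rule mono_onI)
    fix p q assume pq: "p \<in> interior A" "q \<in> interior A" "p \<le> q"
    then have "p \<in> A" "q \<in> A" using interior_subset by auto
    then have "f p + d p * (q - p) \<le> f q" "f q + d q * (p - q) \<le> f p"
      using pq sup by auto
    then have "0 \<le> (d q - d p) * (q - p)" by (simp add: algebra_simps)
    then show "d p \<le> d q" using pq by (cases "p = q") (auto simp: zero_le_mult_iff)
  qed
  with sup show thesis by (rule that)
qed

lemma integral_exp_minus:
  fixes a b :: real
  assumes "a \<le> b"
  shows "((\<lambda>t. exp (- t)) has_integral (exp (- a) - exp (- b))) {a..b}"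
proof -
  have "((\<lambda>t. exp (- t)) has_integral (- exp (- b) - - exp (- a))) {a..b}"
    by (rule fundamental_theorem_of_calculus[OF assms])
       (auto intro!: derivative_eq_intros simp flip: has_real_derivative_iff_has_vector_derivative)
  then show ?thesis by simp
qed

text \<open>The supporting line at \<open>p\<close> is integrated along \<open>exp (- t)\<close>
  over the part of \<open>{a..b}\<close> before \<open>T\<close>. The part after \<open>T\<close> is
  paid for by the sign of the line at 0.\<close>

lemma supporting_line_truncated_integral:
  fixes f :: "real \<Rightarrow> real"
  assumes f: "convex_on {0..1} f" "f 0 = 0"
    and supp: "\<And>u. u \<in> {0..1} \<Longrightarrow> f p + c * (u - p) \<le> f u"
    and "0 \<le> a" "a \<le> b" "0 \<le> T"
  shows "(b - a) * f p + c * (exp (- min a T) - exp (- min b T) - (b - a) * p)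
    \<le> integral {0..min b T} (\<lambda>t. f (exp (- t))) - integral {0..min a T} (\<lambda>t. f (exp (- t)))"
proof -
  define a' b' where "a' = min a T" and "b' = min b T"
  have ab: "0 \<le> a'" "a' \<le> b'" "b' - a' \<le> b - a"
    using assms by (auto simp: a'_def b'_def)
  have int: "(\<lambda>t. f (exp (- t))) integrable_on {0..b'}"
    by (rule convex_exp_integrable[OF f(1)])
  have "((\<lambda>t. (f p - c * p) + c * exp (- t)) has_integral
      ((b' - a') * (f p - c * p) + c * (exp (- a') - exp (- b')))) {a'..b'}"
    using has_integral_add[OF has_integral_const_real[of "f p - c * p" a' b']
        has_integral_mult_right[OF integral_exp_minus[OF ab(2)], of c]] ab by simp
  moreover have "((\<lambda>t. f (exp (- t))) has_integral integral {a'..b'} (\<lambda>t. f (exp (- t)))) {a'..b'}"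
    using integrable_subinterval_real[OF int] ab by (intro integrable_integral) auto
  moreover have "(f p - c * p) + c * exp (- t) \<le> f (exp (- t))" if "t \<in> {a'..b'}" for t
    using supp[of "exp (- t)"] that ab by (simp add: algebra_simps)
  ultimately have "(b' - a') * (f p - c * p) + c * (exp (- a') - exp (- b'))
      \<le> integral {a'..b'} (\<lambda>t. f (exp (- t)))"
    by (rule has_integral_le)
  \<comment> \<open>At \<open>u = 0\<close> the supporting line gives
    \<open>f p - c * p \<le> 0\<close>, so the full length yields the smaller product.\<close>
  moreover have "(b - a) * (f p - c * p) \<le> (b' - a') * (f p - c * p)"
    using supp[of 0] f(2) ab by (intro mult_right_mono_neg) auto
  moreover have "integral {0..a'} (\<lambda>t. f (exp (- t))) + integral {a'..b'} (\<lambda>t. f (exp (- t)))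
      = integral {0..b'} (\<lambda>t. f (exp (- t)))"
    using ab int by (intro Henstock_Kurzweil_Integration.integral_combine) auto
  ultimately show ?thesis
    unfolding a'_def[symmetric] b'_def[symmetric] by (simp add: algebra_simps)
qed

text \<open>The estimates for consecutive intervals telescope on the integral side. The linear terms
  they leave behind are controlled by \<open>bound\<close> and the decreasing slopes.\<close>

lemma karamata_exp_step:
  fixes f :: "real \<Rightarrow> real" and lam p :: "'i \<Rightarrow> real"
  assumes S: "finite S"
    and lam: "\<And>i. i \<in> S \<Longrightarrow> 0 \<le> lam i"
    and p: "\<And>i. i \<in> S \<Longrightarrow> p i \<in> {0<..<1}"
    and f: "convex_on {0..1} f" "f 0 = 0"
    and bound: "\<And>A. A \<subseteq> S \<Longrightarrow> (\<Sum>i\<in>A. lam i * p i) \<le> 1 - exp (- sum lam A)"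
  shows "(\<Sum>i\<in>S. lam i * f (p i))
    \<le> integral {0..- ln (1 - (\<Sum>i\<in>S. lam i * p i))} (\<lambda>t. f (exp (- t)))"
proof -
  define X where "X A = (\<Sum>i\<in>A. lam i * p i)" for A
  define T where "T = - ln (1 - X S)"
  have X_mono: "X A \<le> X S" if "A \<subseteq> S" for A
    unfolding X_def using S that lam p by (intro sum_mono2) (auto simp: less_imp_le)
  have X_less: "exp (- sum lam S) \<le> 1 - X S" using bound[of S] by (simp add: X_def)
  then have pos: "0 < 1 - X S" by (rule less_le_trans[OF exp_gt_zero])
  then have exp_T: "exp (- T) = 1 - X S" by (simp add: T_def)
  have T_le: "T \<le> sum lam S"
    using X_less unfolding exp_T[symmetric] by simp
  have T_ge: "0 \<le> T" using X_mono[of "{}"] pos by (simp add: T_def X_def)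
  obtain d where d: "\<And>q u. q \<in> {0<..<1} \<Longrightarrow> u \<in> {0..1} \<Longrightarrow> f q + d q * (u - q) \<le> f u"
    and d_mono: "mono_on {0<..<1} d"
    using convex_on_mono_supporting_slopes[OF f(1), unfolded interior_atLeastAtMost_real] by blast
  \<comment> \<open>The term with \<open>c\<close> is the boundary term of the summation by parts. Its second factor is
    nonnegative and vanishes for \<open>A = S\<close>.\<close>
  have "A \<subseteq> S \<Longrightarrow> (\<And>i. i \<in> A \<Longrightarrow> c \<le> d (p i)) \<Longrightarrow>
      (\<Sum>i\<in>A. lam i * f (p i)) + c * (1 - exp (- min (sum lam A) T) - X A)
      \<le> integral {0..min (sum lam A) T} (\<lambda>t. f (exp (- t)))" if "finite A" for A c
    using that
  \<comment> \<open>Ranking by \<open>- p i\<close> makes the inserted \<open>m\<close> an index of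
    smallest \<open>p\<close>, so \<open>d (p m)\<close> is an admissible \<open>c\<close> for the
    earlier indices. The rule does not ensure that \<open>m\<close> is new.\<close>
  proof (induction arbitrary: c rule: finite_ranking_induct[where f = "\<lambda>i. - p i"])
    case empty
    show ?case using T_ge by (simp add: X_def)
  next
    case (insert m A)
    show ?case
    proof (cases "m \<in> A")
      case True
      then show ?thesis using insert by (simp add: insert_absorb)
    next
      case False
      let ?F = "\<lambda>b. integral {0..min b T} (\<lambda>t. f (exp (- t)))"
      have sub: "A \<subseteq> S" and m: "m \<in> S" using insert.prems by auto
      have "d (p m) \<le> d (p i)" if "i \<in> A" for i
        using insert.hyps(2)[OF that] p m sub that by (intro mono_onD[OF d_mono]) auto
      with insert.IH[OF sub] have 1: "(\<Sum>i\<in>A. lam i * f (p i))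
          + d (p m) * (1 - exp (- min (sum lam A) T) - X A) \<le> ?F (sum lam A)" by blast
      have [simp]: "sum lam (insert m A) = lam m + sum lam A"
        "X (insert m A) = lam m * p m + X A"
        using False insert.hyps by (auto simp: X_def)
      \<comment> \<open>Both linear terms carry the slope \<open>d (p m)\<close>, so adding this to
        \<open>1\<close> gives the boundary term of \<open>insert m A\<close>.\<close>
      have 2: "lam m * f (p m) + d (p m) *
          (exp (- min (sum lam A) T) - exp (- min (lam m + sum lam A) T) - lam m * p m)
          \<le> ?F (lam m + sum lam A) - ?F (sum lam A)"
        using supporting_line_truncated_integral[OF f d[OF p[OF m]],
            of "sum lam A" "lam m + sum lam A" T] T_ge sub m lam
        by (auto intro!: sum_nonneg)
      \<comment> \<open>Before \<open>T\<close> this is \<open>bound\<close>; from \<open>T\<close>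
        on the right side is \<open>X S\<close>. The sign allows lowering the slope from
        \<open>d (p m)\<close> to \<open>c\<close>.\<close>
      have "X (insert m A) \<le> 1 - exp (- min (sum lam (insert m A)) T)"
        using bound[OF insert.prems(1)] X_mono[OF insert.prems(1)] exp_T
        by (auto simp: X_def min_def)
      then have "c * (1 - exp (- min (sum lam (insert m A)) T) - X (insert m A))
          \<le> d (p m) * (1 - exp (- min (sum lam (insert m A)) T) - X (insert m A))"
        using insert.prems(2)[of m] by (intro mult_right_mono) auto
      with 1 2 show ?thesis using False insert.hyps by (simp add: algebra_simps)
    qed
  qed
  \<comment> \<open>Any lower bound of the slopes would do as \<open>c\<close>, since its factor
    vanishes by \<open>T_le\<close> and \<open>exp_T\<close>.\<close>
  from this[OF S order_refl, of "Min ((\<lambda>i. d (p i)) ` S)"] S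
  show ?thesis using T_le exp_T by (simp add: min_absorb2 flip: X_def T_def)
qed

theorem lemma6:
  fixes I :: "'i set" and J :: "'j set"
    and w :: "'i \<Rightarrow> 'j \<Rightarrow> real" and lam :: "'i \<Rightarrow> real"
    and x :: "'i \<Rightarrow> 'j \<Rightarrow> real" and f :: "real \<Rightarrow> real" and j :: 'j
  assumes "finite I" and "finite J"
    and "\<And>i j. i \<in> I \<Longrightarrow> j \<in> J \<Longrightarrow> 0 \<le> w i j"
    and "\<And>i. i \<in> I \<Longrightarrow> 0 < lam i"
    and "convex_on {0..1} f" and "f 0 = 0"
    and "j \<in> J"
    and "natural_lp_feasible I J lam x"
  shows "(\<Sum>i\<in>I. lam i * f (x i j / lam i))
           \<le> integral {0..- ln (1 - (\<Sum>i\<in>I. x i j))} (\<lambda>t. f (exp (- t)))"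
proof -
  have x_nonneg: "0 \<le> x i j" if "i \<in> I" for i
    using assms(7,8) that by (auto simp: natural_lp_feasible_def)
  have bound: "(\<Sum>i\<in>A. x i j) \<le> 1 - exp (- sum lam A)" if "A \<subseteq> I" for A
    using assms(7,8) that by (auto simp: natural_lp_feasible_def)
  define S where "S = {i \<in> I. x i j \<noteq> 0}"
  have S: "S \<subseteq> I" "finite S" using assms(1) by (auto simp: S_def)
  have cancel: "lam i * (x i j / lam i) = x i j" if "i \<in> I" for i
    using assms(4)[OF that] by simp
  \<comment> \<open>Strictness keeps \<open>x i j / lam i\<close> off the end point 1, where a
    supporting line may be missing.\<close>
  have less: "x i j < lam i" if "i \<in> I" for i
  proof -
    have "1 - lam i < exp (- lam i)" using assms(4)[OF that] by (simp add: exp_minus_greater)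
    then show ?thesis using bound[of "{i}"] that by simp
  qed
  have "(\<Sum>i\<in>S. lam i * f (x i j / lam i))
      \<le> integral {0..- ln (1 - (\<Sum>i\<in>S. lam i * (x i j / lam i)))} (\<lambda>t. f (exp (- t)))"
  proof (rule karamata_exp_step[OF S(2) _ _ assms(5,6)])
    fix i assume "i \<in> S"
    then have "i \<in> I" "x i j \<noteq> 0" by (auto simp: S_def)
    then show "0 \<le> lam i" "x i j / lam i \<in> {0<..<1}"
      using assms(4)[of i] x_nonneg[of i] less[of i] by auto
  next
    fix A assume "A \<subseteq> S"
    then have "A \<subseteq> I" using S by auto
    then show "(\<Sum>i\<in>A. lam i * (x i j / lam i)) \<le> 1 - exp (- sum lam A)"
      using bound[of A] cancel by (simp add: subset_iff)
  qed
  also have "(\<Sum>i\<in>S. lam i * (x i j / lam i)) = (\<Sum>i\<in>I. x i j)"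
    using S cancel assms(1) by (intro sum.mono_neutral_cong_left) (auto simp: S_def)
  also have "(\<Sum>i\<in>S. lam i * f (x i j / lam i)) = (\<Sum>i\<in>I. lam i * f (x i j / lam i))"
    using assms(1,6) by (intro sum.mono_neutral_left) (auto simp: S_def)
  finally show ?thesis .
qed

end
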